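(* Consider the two-regime CRRA model described in the context, with the equilibrium strategy $$\hat\pi(t,x,i)=\frac{\mu_i-r_i}{\sigma_i^2}\,x\,\frac{p(t,i,1)(g^{i,1}(t))^{\frac{\alpha_1}{1-\alpha_1}}+p(t,i,2)(g^{i,2}(t))^{\frac{\alpha_2}{1-\alpha_2}}}{\alpha_1p(t,i,1)(g^{i,1}(t))^{\frac{\alpha_1}{1-\alpha_1}}+\alpha_2p(t,i,2)(g^{i,2}(t))^{\frac{\alpha_2}{1-\alpha_2}}}.$$ If $\alpha_1=\alpha_2=\alpha$, then this equilibrium strategy is given by $$\hat\pi(t,x,i)=\frac{\mu_i-r_i}{\alpha\sigma_i^2}\,x .$$
   Context: Setting. $\mathbb{R}^+=(0,\infty)$, $S=\{1,2\}$. $(\Omega,\mathcal{F},\{\mathcal{F}_t\}_{t\in[0,T]},\mathbb{P})$ is a filtered complete probability space satisfying the usual conditions, $T>0$. $\epsilon$ is an adapted stationary continuous-time Markov chain on $S$ with generator entries $q_{11}=-\lambda_1$, $q_{12}=\lambda_1$, $q_{21}=\lambda_2$, $q_{22}=-\lambda_2$, $\lambda_1,\lambda_2\ge0$. $W$ is a standard Brownian motion with respect to $\{\mathcal{F}_t\}$, independent of $\epsilon$. $r_i,\mu_i,\sigma_i>0$ are constants. The wealth process $X^\pi$ of a strategy $\pi:[0,T]\times\mathbb{R}\times S\to\mathbb{R}$ satisfies $$dX_t^\pi=r_{\epsilon_t}X_t^\pi dt+(\mu_{\epsilon_t}-r_{\epsilon_t})\pi(t,X_t^\pi,\epsilon_t)dt+\pi(t,X_t^\pi,\epsilon_t)\sigma_{\epsilon_t}dW_t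 .$$ Utilities: $u^j(x)=\frac{1}{1-\alpha_j}x^{1-\alpha_j}$, $x>0$, $\alpha_1,\alpha_2\in(0,\infty)\setminus\{1\}$. $\pi$ is admissible ($\pi\in\Pi$) if (i) for every $(t,x,i)\in[0,T)\times\mathbb{R}^+\times S$ the wealth SDE started from $X_t=x,\epsilon_t=i$ has a unique solution, which is a.s. positive on $[t,T]$; (ii) $|\pi(t,x,i)|\le C|x|$ on $[0,T]\times\mathbb{R}\times S$ for some constant $C>0$. Objective: $J^\pi(t,x,i)=\sum_{j\in S}p(t,i,j)(u^j)^{-1}(\mathbb{E}[u^j(X_T^\pi)\mid X_t=x,\epsilon_t=i,\epsilon_T=j])$, with $p(t,i,j)=\mathbb{P}(\epsilon_T=j\mid\epsilon_t=i)$. $\hat\pi\in\Pi$ is an equilibrium strategy if for every $(t,x,i)\in[0,T)\times\mathbb{R}^+\times S$ and $\pi\in\Pi$, whenever $\pi_h\in\Pi$ for all sufficiently small $h>0$, $\limsup_{h\to0^+}\frac{J^{\pi_h}(t,x,i)-J^{\hat\pi}(t,x,i)}{h}\le0$, where $\pi_h$ equals $\pi$ at times $s\in[t,t+h)$ and $\hat\pi$ at times $s\in[t+h,T]$. $\{g^{i,j}\}_{i,j\in S}$ is the unique positive solution on $(-\infty,T]$ of $$\frac{\alpha_j}{1-\alpha_j}g^{i,j}_t(t)=\Big\{\tfrac12\alpha_j\Big(\frac{\mu_i-r_i}{\sigma_i}\Big)^2A_i^2(t)-\Big(\frac{\mu_i-r_i}{\sigma_i}\Big)^2A_i(t)-r_i+\frac{\lambda_i}{1-\alpha_j}\Big[1-\Big(\frac{g^{3-i,j}(t)}{g^{i,j}(t)}\Big)^{\alpha_j}\Big]\Big\}g^{i,j}(t),\quad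 g^{i,j}(T)=1,$$ where $A_i(t)=\dfrac{p(t,i,1)(g^{i,1}(t))^{\alpha_1/(1-\alpha_1)}+p(t,i,2)(g^{i,2}(t))^{\alpha_2/(1-\alpha_2)}}{\alpha_1p(t,i,1)(g^{i,1}(t))^{\alpha_1/(1-\alpha_1)}+\alpha_2p(t,i,2)(g^{i,2}(t))^{\alpha_2/(1-\alpha_2)}}$. Explicitly, if $\lambda_1^2+\lambda_2^2\neq0$, $p(t,i,3-i)=\frac{\lambda_i}{\lambda_1+\lambda_2}[1-e^{-(\lambda_1+\lambda_2)(T-t)}]$ and $p(t,i,i)=1-p(t,i,3-i)$; if $\lambda_1=\lambda_2=0$, $p(t,i,i)=1$, $p(t,i,3-i)=0$. *)

theory Defs
  imports "HOL-Probability.Probability"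
begin

text \<open>
  The regimes are the natural numbers 1 and 2, so that the other regime of \<open>i\<close> is \<open>3 - i\<close>.
  Regime-indexed data are functions on \<open>nat\<close>, only used on \<open>{1, 2}\<close>.
\<close>

section \<open>The regime chain\<close>

definition generator :: "(nat \<Rightarrow> real) \<Rightarrow> nat \<Rightarrow> nat \<Rightarrow> real" where
  "generator lam i j = (if j = i then - lam i else lam i)"

text \<open>\<open>P s i j\<close> is the probability of going from \<open>i\<close> to \<open>j\<close> in a time span of length \<open>s\<close>.\<close>

definition transition_semigroup ::
    "(nat \<Rightarrow> nat \<Rightarrow> real) \<Rightarrow> (real \<Rightarrow> nat \<Rightarrow> nat \<Rightarrow> real) \<Rightarrow> bool" where
  "transition_semigroup Q P \<longleftrightarrow>
     (\<forall>s\<ge>0. \<forall>i\<in>{1, 2}. (\<forall>j\<in>{1, 2}. 0 \<le> P s i j) \<and> (\<Sum>j\<in>{1, 2}. P s i j) = 1) \<and>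
     (\<forall>i\<in>{1, 2}. \<forall>j\<in>{1, 2}. P 0 i j = (if i = j then 1 else 0)) \<and>
     (\<forall>s\<ge>0. \<forall>s'\<ge>0. \<forall>i\<in>{1, 2}. \<forall>j\<in>{1, 2}.
        P (s + s') i j = (\<Sum>k\<in>{1, 2}. P s i k * P s' k j)) \<and>
     (\<forall>i\<in>{1, 2}. \<forall>j\<in>{1, 2}.
        ((\<lambda>s. P s i j) has_real_derivative Q i j) (at 0 within {0..}))"

text \<open>
  \<open>P(eps\<^sub>T = j | eps\<^sub>t = i)\<close> in closed form. This is needed besides the conditional probability
  itself because the functions \<open>g\<close> below live on all of \<open>(-\<infinity>, T]\<close>, the chain only on \<open>[0, T]\<close>.
\<close>

definition trans_prob :: "(nat \<Rightarrow> real) \<Rightarrow> real \<Rightarrow> real \<Rightarrow> nat \<Rightarrow> nat \<Rightarrow> real" where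
  "trans_prob lam T t i j =
     (let q = (if (lam 1)^2 + (lam 2)^2 \<noteq> 0
               then lam i / (lam 1 + lam 2) * (1 - exp (- (lam 1 + lam 2) * (T - t))) else 0)
      in if j = i then 1 - q else q)"

section \<open>Stochastic integrals\<close>

definition progressive ::
    "(real \<Rightarrow> 'a measure) \<Rightarrow> real \<Rightarrow> real \<Rightarrow> (real \<Rightarrow> 'a \<Rightarrow> real) \<Rightarrow> bool" where
  "progressive F t T H \<longleftrightarrow>
     (\<forall>s\<in>{t..T}. (\<lambda>(v, \<omega>). H v \<omega>) \<in> borel_measurable (restrict_space borel {t..s} \<Otimes>\<^sub>M F s))"

text \<open>
  A simple integrand on \<open>[t, T]\<close> takes the value \<open>\<xi> k\<close> on \<open>(\<tau> k, \<tau> (k + 1)]\<close> for \<open>k < m\<close>.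
\<close>

definition simple_integrand ::
    "(real \<Rightarrow> 'a measure) \<Rightarrow> real \<Rightarrow> real \<Rightarrow> nat \<Rightarrow> (nat \<Rightarrow> real) \<Rightarrow> (nat \<Rightarrow> 'a \<Rightarrow> real) \<Rightarrow> bool" where
  "simple_integrand F t T m \<tau> \<xi> \<longleftrightarrow>
     \<tau> 0 = t \<and> \<tau> m = T \<and> (\<forall>k<m. \<tau> k \<le> \<tau> (Suc k)) \<and>
     (\<forall>k<m. \<xi> k \<in> borel_measurable (F (\<tau> k)) \<and> (\<exists>B. \<forall>\<omega>\<in>space (F (\<tau> k)). \<bar>\<xi> k \<omega>\<bar> \<le> B))"

definition simple_process ::
    "nat \<Rightarrow> (nat \<Rightarrow> real) \<Rightarrow> (nat \<Rightarrow> 'a \<Rightarrow> real) \<Rightarrow> real \<Rightarrow> 'a \<Rightarrow> real" where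
  "simple_process m \<tau> \<xi> s \<omega> = (\<Sum>k<m. \<xi> k \<omega> * indicator {\<tau> k<..\<tau> (Suc k)} s)"

definition simple_integral ::
    "(real \<Rightarrow> 'a \<Rightarrow> real) \<Rightarrow> nat \<Rightarrow> (nat \<Rightarrow> real) \<Rightarrow> (nat \<Rightarrow> 'a \<Rightarrow> real) \<Rightarrow> real \<Rightarrow> 'a \<Rightarrow> real" where
  "simple_integral W m \<tau> \<xi> s \<omega> =
     (\<Sum>k<m. \<xi> k \<omega> * (W (min s (\<tau> (Suc k))) \<omega> - W (min s (\<tau> k)) \<omega>))"

text \<open>
  \<open>Y\<^sub>s = \<integral>\<^sub>t\<^sup>s H dW\<close> for \<open>s \<in> [t, T]\<close>, up to indistinguishability under the measure \<open>N\<close>: \<open>Y\<close> is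
  adapted and continuous, and there are simple integrands that converge to \<open>H\<close> in \<open>L\<^sup>2[t, T]\<close>
  in probability and whose elementary integrals converge to \<open>Y\<close> in probability. Convergence at
  every time, together with the continuity of \<open>Y\<close>, identifies \<open>Y\<close>. The existence of the
  approximation forces \<open>\<integral>\<^sub>t\<^sup>T H\<^sup>2 ds < \<infinity>\<close> almost surely.
\<close>

definition ito_integral ::
    "'a measure \<Rightarrow> (real \<Rightarrow> 'a measure) \<Rightarrow> (real \<Rightarrow> 'a \<Rightarrow> real) \<Rightarrow> real \<Rightarrow> real \<Rightarrow>
     (real \<Rightarrow> 'a \<Rightarrow> real) \<Rightarrow> (real \<Rightarrow> 'a \<Rightarrow> real) \<Rightarrow> bool" where
  "ito_integral N F W t T H Y \<longleftrightarrow>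
     progressive F t T H \<and>
     (\<forall>s\<in>{t..T}. Y s \<in> borel_measurable (F s)) \<and>
     (AE \<omega> in N. continuous_on {t..T} (\<lambda>s. Y s \<omega>)) \<and>
     (\<exists>m \<tau> \<xi>. (\<forall>n. simple_integrand F t T (m n) (\<tau> n) (\<xi> n)) \<and>
        (\<forall>e>0. (\<lambda>n. measure N {\<omega> \<in> space N.
             (\<integral>\<^sup>+s\<in>{t..T}. ennreal ((simple_process (m n) (\<tau> n) (\<xi> n) s \<omega> - H s \<omega>)^2) \<partial>lborel) >
             ennreal e}) \<longlonglongrightarrow> 0) \<and>
        (\<forall>s\<in>{t..T}. \<forall>e>0. (\<lambda>n. measure N {\<omega> \<in> space N.
             \<bar>simple_integral W (m n) (\<tau> n) (\<xi> n) s \<omega> - Y s \<omega>\<bar> > e}) \<longlonglongrightarrow> 0))"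

section \<open>The market\<close>

definition crra :: "real \<Rightarrow> real \<Rightarrow> real" where
  "crra a x = x powr (1 - a) / (1 - a)"

text \<open>Only the times in \<open>[0, T]\<close> of \<open>F\<close>, \<open>eps\<close> and \<open>W\<close> matter.\<close>

locale regime_market = prob_space M + complete_measure M
  for M :: "'a measure" +
  fixes F :: "real \<Rightarrow> 'a measure"
    and T :: real
    and eps :: "real \<Rightarrow> 'a \<Rightarrow> nat"
    and W :: "real \<Rightarrow> 'a \<Rightarrow> real"
    and lam r mu sig alpha :: "nat \<Rightarrow> real"
  assumes T_pos: "0 < T"
    and filtration_sub: "\<And>t. t \<in> {0..T} \<Longrightarrow> subalgebra M (F t)"
    and filtration_mono: "mono_on {0..T} (\<lambda>t. sets (F t))"
    and filtration_right_cont: "\<And>t. t \<in> {0..<T} \<Longrightarrow> sets (F t) = (\<Inter>s\<in>{t<..T}. sets (F s))"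
    and filtration_null: "null_sets M \<subseteq> sets (F 0)"
    and lam_nonneg: "\<And>i. i \<in> {1, 2} \<Longrightarrow> 0 \<le> lam i"
    and coeff_pos: "\<And>i. i \<in> {1, 2} \<Longrightarrow> 0 < r i \<and> 0 < mu i \<and> 0 < sig i"
    and alpha_range: "\<And>i. i \<in> {1, 2} \<Longrightarrow> 0 < alpha i \<and> alpha i \<noteq> 1"
    and eps_range: "\<And>t \<omega>. t \<in> {0..T} \<Longrightarrow> \<omega> \<in> space M \<Longrightarrow> eps t \<omega> \<in> {1, 2}"
    and eps_adapted: "\<And>t. t \<in> {0..T} \<Longrightarrow> eps t \<in> measurable (F t) (count_space UNIV)"
    and eps_right_cont: "\<And>t \<omega>. t \<in> {0..<T} \<Longrightarrow> \<omega> \<in> space M \<Longrightarrow>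
          \<forall>\<^sub>F s in at_right t. eps s \<omega> = eps t \<omega>"
    and eps_left_limit: "\<And>t \<omega>. t \<in> {0<..T} \<Longrightarrow> \<omega> \<in> space M \<Longrightarrow>
          \<exists>k. \<forall>\<^sub>F s in at_left t. eps s \<omega> = k"
    and eps_markov: "\<exists>P. transition_semigroup (generator lam) P \<and>
          (\<forall>t\<in>{0..T}. \<forall>s\<in>{t..T}. \<forall>j\<in>{1, 2}. AE \<omega> in M.
             real_cond_exp M (F t) (\<lambda>\<omega>. if eps s \<omega> = j then 1 else 0) \<omega> = P (s - t) (eps t \<omega>) j)"
    and W_adapted: "\<And>t. t \<in> {0..T} \<Longrightarrow> W t \<in> borel_measurable (F t)"
    and W_zero: "AE \<omega> in M. W 0 \<omega> = 0"
    and W_continuous: "AE \<omega> in M. continuous_on {0..T} (\<lambda>t. W t \<omega>)"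
    and W_normal: "\<And>s t. 0 \<le> s \<Longrightarrow> s < t \<Longrightarrow> t \<le> T \<Longrightarrow>
          distributed M lborel (\<lambda>\<omega>. W t \<omega> - W s \<omega>) (normal_density 0 (sqrt (t - s)))"
    and W_indep_increments: "\<And>s t. 0 \<le> s \<Longrightarrow> s < t \<Longrightarrow> t \<le> T \<Longrightarrow>
          indep_set (sets (F s)) (sets (vimage_algebra (space M) (\<lambda>\<omega>. W t \<omega> - W s \<omega>) borel))"
    and W_eps_indep: "indep_var
          (PiM {0..T} (\<lambda>_. borel)) (\<lambda>\<omega>. restrict (\<lambda>t. W t \<omega>) {0..T})
          (PiM {0..T} (\<lambda>_. count_space UNIV)) (\<lambda>\<omega>. restrict (\<lambda>t. eps t \<omega>) {0..T})"
begin

text \<open>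
  Conditioning on \<open>eps t = i\<close>. If this event is null then \<open>given t i\<close> is the null measure:
  statements that hold almost everywhere become vacuous and integrals vanish, so that such a
  starting point \<open>(t, i)\<close> imposes no existence, uniqueness or optimality requirement. Since the event
  belongs to \<open>F t\<close>, the increments of \<open>W\<close> after time \<open>t\<close> are Brownian under \<open>given t i\<close>
  whenever the event is not null.
\<close>

definition "given" :: "real \<Rightarrow> nat \<Rightarrow> 'a measure" where
  "given t i = uniform_measure M {\<omega> \<in> space M. eps t \<omega> = i}"

definition wealth_solution ::
    "(real \<Rightarrow> real \<Rightarrow> nat \<Rightarrow> real) \<Rightarrow> real \<Rightarrow> real \<Rightarrow> nat \<Rightarrow> (real \<Rightarrow> 'a \<Rightarrow> real) \<Rightarrow> bool" where
  "wealth_solution \<pi> t x i X \<longleftrightarrow>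
     progressive F t T X \<and>
     progressive F t T (\<lambda>s \<omega>. \<pi> s (X s \<omega>) (eps s \<omega>)) \<and>
     (AE \<omega> in given t i. continuous_on {t..T} (\<lambda>s. X s \<omega>)) \<and>
     (AE \<omega> in given t i. set_integrable lborel {t..T} (\<lambda>s.
        r (eps s \<omega>) * X s \<omega> + (mu (eps s \<omega>) - r (eps s \<omega>)) * \<pi> s (X s \<omega>) (eps s \<omega>))) \<and>
     (\<exists>Y. ito_integral (given t i) F W t T (\<lambda>s \<omega>. \<pi> s (X s \<omega>) (eps s \<omega>) * sig (eps s \<omega>)) Y \<and>
        (AE \<omega> in given t i. \<forall>s\<in>{t..T}.
           X s \<omega> = x
             + (LBINT v:{t..s}. r (eps v \<omega>) * X v \<omega>
                  + (mu (eps v \<omega>) - r (eps v \<omega>)) * \<pi> v (X v \<omega>) (eps v \<omega>))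
             + Y s \<omega>))"

definition admissible :: "(real \<Rightarrow> real \<Rightarrow> nat \<Rightarrow> real) \<Rightarrow> bool" where
  "admissible \<pi> \<longleftrightarrow>
     (\<forall>t\<in>{0..<T}. \<forall>x>0. \<forall>i\<in>{1, 2}.
        (\<exists>X. wealth_solution \<pi> t x i X \<and> (AE \<omega> in given t i. \<forall>s\<in>{t..T}. 0 < X s \<omega>)) \<and>
        (\<forall>X X'. wealth_solution \<pi> t x i X \<longrightarrow> wealth_solution \<pi> t x i X' \<longrightarrow>
           (AE \<omega> in given t i. \<forall>s\<in>{t..T}. X s \<omega> = X' s \<omega>))) \<and>
     (\<exists>C>0. \<forall>t\<in>{0..T}. \<forall>x. \<forall>i\<in>{1, 2}. \<bar>\<pi> t x i\<bar> \<le> C * \<bar>x\<bar>)"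

definition wealth :: "(real \<Rightarrow> real \<Rightarrow> nat \<Rightarrow> real) \<Rightarrow> real \<Rightarrow> real \<Rightarrow> nat \<Rightarrow> real \<Rightarrow> 'a \<Rightarrow> real" where
  "wealth \<pi> t x i = (SOME X. wealth_solution \<pi> t x i X)"

text \<open>
  Conditioning on \<open>X\<^sub>t = x\<close> is the initial condition of the wealth equation. If \<open>eps t = i\<close> and
  \<open>eps T = j\<close> is a null event then the weight of the \<open>j\<close>-th summand is 0.
\<close>

definition objective :: "(real \<Rightarrow> real \<Rightarrow> nat \<Rightarrow> real) \<Rightarrow> real \<Rightarrow> real \<Rightarrow> nat \<Rightarrow> real" where
  "objective \<pi> t x i =
     (\<Sum>j\<in>{1, 2}. \<P>(\<omega> in M. eps T \<omega> = j \<bar> eps t \<omega> = i) *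
        the_inv_into {0<..} (crra (alpha j))
          (\<integral>\<omega>. crra (alpha j) (wealth \<pi> t x i T \<omega>)
             \<partial>uniform_measure M {\<omega> \<in> space M. eps t \<omega> = i \<and> eps T \<omega> = j}))"

definition perturbed ::
    "(real \<Rightarrow> real \<Rightarrow> nat \<Rightarrow> real) \<Rightarrow> (real \<Rightarrow> real \<Rightarrow> nat \<Rightarrow> real) \<Rightarrow> real \<Rightarrow> real \<Rightarrow>
     real \<Rightarrow> real \<Rightarrow> nat \<Rightarrow> real" where
  "perturbed \<pi> \<pi>' t h s = (if s \<in> {t..<t + h} then \<pi> s else \<pi>' s)"

definition equilibrium :: "(real \<Rightarrow> real \<Rightarrow> nat \<Rightarrow> real) \<Rightarrow> bool" where
  "equilibrium \<pi>' \<longleftrightarrow> admissible \<pi>' \<and>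
     (\<forall>t\<in>{0..<T}. \<forall>x>0. \<forall>i\<in>{1, 2}. \<forall>\<pi>. admissible \<pi> \<longrightarrow>
        (\<forall>\<^sub>F h in at_right 0. admissible (perturbed \<pi> \<pi>' t h)) \<longrightarrow>
        Limsup (at_right 0) (\<lambda>h.
          ereal ((objective (perturbed \<pi> \<pi>' t h) t x i - objective \<pi>' t x i) / h)) \<le> 0)"

end

section \<open>The system for \<open>g\<close>\<close>

definition A_ratio ::
    "(nat \<Rightarrow> real) \<Rightarrow> real \<Rightarrow> (nat \<Rightarrow> real) \<Rightarrow> (nat \<Rightarrow> nat \<Rightarrow> real \<Rightarrow> real) \<Rightarrow> nat \<Rightarrow> real \<Rightarrow> real" where
  "A_ratio lam T alpha g i t =
     (trans_prob lam T t i 1 * g i 1 t powr (alpha 1 / (1 - alpha 1)) +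
      trans_prob lam T t i 2 * g i 2 t powr (alpha 2 / (1 - alpha 2))) /
     (alpha 1 * trans_prob lam T t i 1 * g i 1 t powr (alpha 1 / (1 - alpha 1)) +
      alpha 2 * trans_prob lam T t i 2 * g i 2 t powr (alpha 2 / (1 - alpha 2)))"

definition positive_g_solution ::
    "(nat \<Rightarrow> real) \<Rightarrow> real \<Rightarrow> (nat \<Rightarrow> real) \<Rightarrow> (nat \<Rightarrow> real) \<Rightarrow> (nat \<Rightarrow> real) \<Rightarrow> (nat \<Rightarrow> real) \<Rightarrow>
     (nat \<Rightarrow> nat \<Rightarrow> real \<Rightarrow> real) \<Rightarrow> bool" where
  "positive_g_solution lam T r mu sig alpha g \<longleftrightarrow>
     (\<forall>i\<in>{1, 2}. \<forall>j\<in>{1, 2}. g i j T = 1 \<and>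
        (\<forall>t\<le>T. 0 < g i j t \<and>
           (\<exists>g'. (g i j has_real_derivative g') (at t within {..T}) \<and>
              alpha j / (1 - alpha j) * g' =
                (1/2 * alpha j * ((mu i - r i) / sig i)^2 * (A_ratio lam T alpha g i t)^2
                 - ((mu i - r i) / sig i)^2 * A_ratio lam T alpha g i t - r i
                 + lam i / (1 - alpha j) * (1 - (g (3 - i) j t / g i j t) powr alpha j))
                * g i j t)))"

end

theory Submission
  imports Defs
begin

text \<open>With a common risk aversion \<open>a\<close>, both exponents equal
  \<open>a / (1 - a)\<close>, so the fraction in the strategy has some numerator \<open>S\<close>
  and denominator \<open>a * S\<close>, and collapses to \<open>1 / a\<close>. Cancelling requires
  \<open>S\<close> to be nonzero. In fact \<open>S\<close> is positive: it averages positive powers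
  of \<open>g\<close> with the weights \<open>trans_prob\<close>, which are nonnegative and sum to
  1.\<close>

text \<open>The probability \<open>q\<close> of ending in the other regime is 0 or a product of two
  factors in [0, 1], so both \<open>q\<close> and \<open>1 - q\<close> are nonnegative.\<close>

lemma trans_prob_nonneg:
  assumes "\<And>i. i \<in> {1, 2} \<Longrightarrow> 0 \<le> lam i" "t \<le> T" "i \<in> {1, 2}"
  shows "0 \<le> trans_prob lam T t i j"
proof -
  define q where "q = (if (lam 1)^2 + (lam 2)^2 \<noteq> 0
               then lam i / (lam 1 + lam 2) * (1 - exp (- (lam 1 + lam 2) * (T - t))) else 0)"
  have nonneg: "0 \<le> lam 1" "0 \<le> lam 2"
    using assms(1) by auto
  \<comment> \<open>If both rates vanish, the quotient is 0 by convention, so the bounds need no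
    case split.\<close>
  have frac: "0 \<le> lam i / (lam 1 + lam 2)" "lam i / (lam 1 + lam 2) \<le> 1"
    using nonneg assms(3) by (auto simp: divide_le_eq)
  have "0 \<le> (lam 1 + lam 2) * (T - t)"
    using nonneg assms(2) by simp
  then have decay: "0 \<le> 1 - exp (- (lam 1 + lam 2) * (T - t))"
    "1 - exp (- (lam 1 + lam 2) * (T - t)) \<le> 1"
    \<comment> \<open>Pulling the sign out makes the exponent the negative of the product just shown
      nonnegative.\<close>
    by (simp_all only: mult_minus_left) simp_all
  have "0 \<le> q" "q \<le> 1"
    using mult_nonneg_nonneg[OF frac(1) decay(1)] mult_le_one[OF frac(2) decay]
    unfolding q_def by simp_all
  then show ?thesis
    unfolding trans_prob_def q_def by (simp add: Let_def)
qed

lemma trans_prob_sum: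
  assumes "i \<in> {1, 2}"
  shows "trans_prob lam T t i 1 + trans_prob lam T t i 2 = 1"
  using assms unfolding trans_prob_def by (auto simp: Let_def)

text \<open>The weights cannot both vanish: if \<open>p = 0\<close>, then \<open>q = 1\<close> and
  the sum is \<open>v\<close>; otherwise \<open>p * u\<close> is already positive.\<close>

lemma convex_combination_pos:
  fixes p q u v :: real
  assumes "0 \<le> p" "0 \<le> q" "p + q = 1" "0 < u" "0 < v"
  shows "0 < p * u + q * v"
  using assms by (cases "p = 0") (auto intro: add_pos_nonneg)

theorem corollary4p10:
  fixes M :: "'a measure"
    and F :: "real \<Rightarrow> 'a measure"
    and T a :: real
    and eps :: "real \<Rightarrow> 'a \<Rightarrow> nat"
    and W :: "real \<Rightarrow> 'a \<Rightarrow> real"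
    and lam r mu sig alpha :: "nat \<Rightarrow> real"
    and g :: "nat \<Rightarrow> nat \<Rightarrow> real \<Rightarrow> real"
    and pihat :: "real \<Rightarrow> real \<Rightarrow> nat \<Rightarrow> real"
  assumes market: "regime_market M F T eps W lam r mu sig alpha"
    and g: "positive_g_solution lam T r mu sig alpha g"
    and equilibrium: "regime_market.equilibrium M F T eps W r mu sig alpha pihat"
    and pihat: "\<forall>t\<in>{0..T}. \<forall>x. \<forall>i\<in>{1, 2}. pihat t x i =
      (mu i - r i) / (sig i)^2 * x *
      ((trans_prob lam T t i 1 * g i 1 t powr (alpha 1 / (1 - alpha 1)) +
        trans_prob lam T t i 2 * g i 2 t powr (alpha 2 / (1 - alpha 2))) /
       (alpha 1 * trans_prob lam T t i 1 * g i 1 t powr (alpha 1 / (1 - alpha 1)) +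
        alpha 2 * trans_prob lam T t i 2 * g i 2 t powr (alpha 2 / (1 - alpha 2))))"
    and alpha_eq: "alpha 1 = a" "alpha 2 = a"
  shows "\<forall>t\<in>{0..T}. \<forall>x. \<forall>i\<in>{1, 2}. pihat t x i = (mu i - r i) / (a * (sig i)^2) * x"
proof (intro ballI allI)
  fix t x :: real and i :: nat
  assume t: "t \<in> {0..T}" and i: "i \<in> {1, 2}"
  define e where "e = a / (1 - a)"
  define S where "S = trans_prob lam T t i 1 * g i 1 t powr e + trans_prob lam T t i 2 * g i 2 t powr e"
  have "0 < g i j t" if "j \<in> {1, 2}" for j
    using g that t i unfolding positive_g_solution_def atLeastAtMost_iff by blast
  \<comment> \<open>A real \<open>powr\<close> is positive exactly when its base is nonzero.\<close>
  then have "0 < g i 1 t powr e" "0 < g i 2 t powr e"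
    by (simp_all add: order.strict_implies_not_eq[symmetric])
  then have "0 < S"
    using trans_prob_nonneg[OF regime_market.lam_nonneg[OF market]] trans_prob_sum t i
    unfolding S_def by (intro convex_combination_pos) auto
  then have "S / (a * S) = 1 / a"
    by simp
  \<comment> \<open>Expanding \<open>a * S\<close> termwise gives the denominator in the formula for
    \<open>pihat\<close>.\<close>
  moreover have "pihat t x i = (mu i - r i) / (sig i)^2 * x * (S / (a * S))"
    unfolding pihat[rule_format, OF t i] alpha_eq S_def e_def by (simp only: distrib_left mult.assoc)
  ultimately show "pihat t x i = (mu i - r i) / (a * (sig i)^2) * x"
    by simp
qed

end
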